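(* Let $N\ge 1$ be an integer, let $m\ge 1$ be a divisor of $N$, and let $n\in\mathbb{Z}$. Then $$\frac{N}{m}\sum_{d\mid N}\ \sum_{l=1}^{\gcd(d,m)}\gcd\!\left(\gcd(d,m),\ n+\frac{l\,d}{\gcd(d,m)}\right)\;=\;N\sum_{d\mid N}\gcd\!\left(d,\,m,\,\frac{N}{d},\,\frac{N}{m},\,n\right).$$
   Context: Sums $\sum_{d\mid N}$ run over the positive divisors $d$ of $N$. The gcd is always non-negative, with $\gcd(a,0)=|a|$. (The left-hand side is the semi-classical count $I^{\mathcal N=1^\ast}(N,m,n)$ of massive vacua of the $\mathcal{N}=1^\ast$ theory $(\mathrm{SU}(N)/\mathbb{Z}_m)_n$ on $\mathbb{R}^3\times S^1$; this interpretation is not needed for the claim.) *)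

theory Defs
  imports Complex_Main
begin

end

theory Submission
  imports Defs "HOL-Number_Theory.Totient"
begin

text \<open>Put \<open>M = N div m\<close>. Expanding \<open>gcd(g, x)\<close> as the sum of \<open>totient e\<close> over the common
  divisors \<open>e\<close> of \<open>g\<close> and \<open>x\<close>, and counting the solutions \<open>l\<close> of a linear congruence modulo \<open>e\<close>,
  turns the left-hand side into a sum over triples \<open>(g, c, e)\<close> with \<open>g = gcd(d, m)\<close>, \<open>d = g c\<close> and
  \<open>e\<close> dividing \<open>g\<close>, in which \<open>n\<close> enters only through the condition that \<open>h = gcd(e, c)\<close> divides \<open>n\<close>.
  For fixed \<open>h\<close>, write \<open>e = h e'\<close>, \<open>c = h k\<close> and \<open>v = e' (m / g)\<close>. The sum of \<open>totient (h e')\<close> over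
  the divisors \<open>e'\<close> of \<open>v\<close> with \<open>v / e'\<close> coprime to \<open>h\<close> is \<open>v totient(h)\<close>, and what remains counts
  the pairs \<open>(k, v)\<close> of coprime divisors of \<open>M / h\<close> and \<open>m / h\<close>, that is, the divisors of
  \<open>N / h^2\<close>. These are the \<open>d / h\<close> for the divisors \<open>d\<close> of \<open>N\<close> such that \<open>h\<close> divides both \<open>d\<close> and
  \<open>N / d\<close>, so the total is the totient expansion of the right-hand side.\<close>

section \<open>Counting solutions of linear congruences in an interval\<close>

lemma card_periodic:
  fixes P :: "nat \<Rightarrow> bool"
  assumes periodic: "\<And>l. P (l + k) = P l"
  shows "card {l \<in> {1..q * k}. P l} = q * card {l \<in> {1..k}. P l}"
proof (induction q)
  case (Suc q)
  let ?A = "{l \<in> {1..k}. P l}" and ?B = "{l \<in> {1..q * k}. P l}"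
  have "l \<in> ?A \<union> (\<lambda>l. l + k) ` ?B" if "l \<in> {1..Suc q * k}" "P l" for l
  proof (cases "l \<le> k")
    case False
    then have "l = (l - k) + k" "l - k \<in> {1..q * k}" using that by auto
    moreover from this have "P (l - k)" using periodic[of "l - k"] that by simp
    ultimately show ?thesis by blast
  qed (use that in auto)
  moreover have "?A \<union> (\<lambda>l. l + k) ` ?B \<subseteq> {l \<in> {1..Suc q * k}. P l}"
    using periodic by auto
  ultimately have "{l \<in> {1..Suc q * k}. P l} = ?A \<union> (\<lambda>l. l + k) ` ?B"
    by blast
  moreover have "card (?A \<union> (\<lambda>l. l + k) ` ?B) = card ?A + card ((\<lambda>l. l + k) ` ?B)"
    by (intro card_Un_disjoint) auto
  moreover have "card ((\<lambda>l. l + k) ` ?B) = card ?B"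
    by (simp add: card_image)
  ultimately show ?case using Suc.IH by simp
qed auto

lemma card_cong_solutions:
  fixes k q :: nat and a :: int
  assumes "k > 0"
  shows "card {l \<in> {1..q * k}. [int l = a] (mod int k)} = q"
proof -
  define z where "z = (- a) mod int k"
  \<comment> \<open>The interval starts at 1, not 0: subtracting the residue of \<open>- a\<close>
    from \<open>k\<close> gives the representative of \<open>a\<close> in
    \<open>{1..k}\<close>.\<close>
  define r where "r = k - nat z"
  have "0 \<le> z" "z < int k" using assms by (auto simp: z_def)
  then have r: "r \<in> {1..k}" "int r = int k - z"
    unfolding r_def by auto
  have cong_r: "[int r = a] (mod int k)"
    unfolding r(2) z_def by (simp add: cong_def mod_simps)
  have "{l \<in> {1..k}. [int l = a] (mod int k)} = {r}"
  proof (intro equalityI subsetI)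
    fix l assume "l \<in> {l \<in> {1..k}. [int l = a] (mod int k)}"
    then have l: "l \<in> {1..k}" "[int l = int r] (mod int k)"
      using cong_r cong_trans cong_sym by blast+
    have "[l = r] (mod k)" using l(2) by (simp add: cong_int_iff)
    \<comment> \<open>Shifting by one moves both numbers from \<open>{1..k}\<close> into
      \<open>{0..<k}\<close>, where congruent numbers are equal.\<close>
    then have "[l - 1 = r - 1] (mod k)"
      using l r cong_diff_nat[of l r k 1 1] by auto
    then have "l - 1 = r - 1" 
      using l r by (intro cong_less_modulus_unique_nat) auto
    then show "l \<in> {r}" using l r by auto
  qed (use r cong_r in auto)
  then show ?thesis
    using card_periodic[of "\<lambda>l. [int l = a] (mod int k)" k q] by (simp add: cong_def)
qed

text \<open>A solution forces \<open>gcd e c\<close> to divide \<open>n\<close>, since it divides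
  \<open>e\<close> and \<open>l * c\<close>. Dividing it out leaves a coefficient invertible modulo
  \<open>e' = e div gcd e c\<close>, so \<open>l\<close> runs through one residue class modulo
  \<open>e'\<close>, which meets \<open>{1..g}\<close> in \<open>g div e'\<close> points.\<close>

lemma card_linear_cong_solutions:
  fixes g c e :: nat and n :: int
  assumes "g > 0" and "e dvd g"
  shows "card {l \<in> {1..g}. int e dvd n + int (l * c)} =
    (if int (gcd e c) dvd n then g div e * gcd e c else 0)"
proof (cases "int (gcd e c) dvd n")
  case False
  have "\<not> int e dvd n + int (l * c)" for l
  proof
    assume "int e dvd n + int (l * c)"
    then have "int (gcd e c) dvd n + int (l * c)"
      by (meson dvd_trans gcd_dvd1 of_nat_dvd_iff)
    moreover have "int (gcd e c) dvd int (l * c)"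
      by (simp only: of_nat_dvd_iff) auto
    ultimately show False using False by (simp only: dvd_add_left_iff)
  qed
  with False show ?thesis by simp
next
  case True
  have "e > 0" using assms by (metis dvd_0_left_iff gr0I)
  define h where "h = gcd e c"
  have "h > 0" using \<open>e > 0\<close> by (simp add: h_def)
  obtain e' c' where ec: "e = h * e'" "c = h * c'" "coprime e' c'"
    using gcd_coprime_exists[of e c] \<open>e > 0\<close> by (metis h_def mult.commute neq0_conv gcd_eq_0_iff)
  obtain n' where n': "n = int h * n'" using True by (auto simp: h_def)
  obtain u where u: "[int c' * u = 1] (mod int e')"
    using cong_solve_coprime_int[of "int c'" "int e'"] ec(3)
    by (auto simp: coprime_commute)
  have iff: "int e dvd n + int (l * c) \<longleftrightarrow> [int l = - n' * u] (mod int e')" for l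
  proof -
    have "n + int (l * c) = int h * (n' + int l * int c')" by (simp add: n' ec algebra_simps)
    then have "int e dvd n + int (l * c) \<longleftrightarrow> int e' dvd n' + int l * int c'"
      using \<open>h > 0\<close> by (simp add: ec)
    also have "\<dots> \<longleftrightarrow> [int c' * int l = - n'] (mod int e')"
      by (simp add: cong_iff_dvd_diff algebra_simps)
    also have "\<dots> \<longleftrightarrow> [int c' * int l = int c' * (- n' * u)] (mod int e')"
    proof -
      have "[int c' * u * (- n') = 1 * (- n')] (mod int e')"
        using u by (rule cong_scalar_right)
      then have "[int c' * (- n' * u) = - n'] (mod int e')" by (simp add: algebra_simps)
      then show ?thesis by (meson cong_sym cong_trans)
    qed
    also have "\<dots> \<longleftrightarrow> [int l = - n' * u] (mod int e')"
      using ec(3) by (intro cong_mult_lcancel) (auto simp: coprime_commute)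
    finally show ?thesis .
  qed
  obtain r where r: "g = e * r" using assms by auto
  have "{l \<in> {1..g}. int e dvd n + int (l * c)}
      = {l \<in> {1..(r * h) * e'}. [int l = - n' * u] (mod int e')}"
    unfolding iff by (simp add: r ec mult_ac)
  also have "card \<dots> = r * h"
    using \<open>e > 0\<close> ec by (intro card_cong_solutions) auto
  finally show ?thesis using True \<open>e > 0\<close> by (simp add: r h_def)
qed

section \<open>Totient expansions\<close>

text \<open>Gauss's totient identity, padded with zeros so that the range of \<open>e\<close> does
  not depend on \<open>x\<close>; the sum over \<open>e\<close> can then be exchanged with a sum
  over values of \<open>x\<close>.\<close>

lemma sum_totient_common_divisors:
  fixes g :: nat and x :: int
  assumes "g > 0"
  shows "gcd (int g) x = int (\<Sum>e | e dvd g. if int e dvd x then totient e else 0)"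
proof -
  have "gcd (int g) x = int (nat (gcd (int g) x))" by simp
  also have "nat (gcd (int g) x) = (\<Sum>e | e dvd nat (gcd (int g) x). totient e)"
    by (simp add: totient_divisor_sum)
  also have "{e. e dvd nat (gcd (int g) x)} = {e. e dvd g \<and> int e dvd x}"
  proof -
    have "e dvd nat (gcd (int g) x) \<longleftrightarrow> int e dvd gcd (int g) x" for e
      by (metis gcd_ge_0_int int_nat_eq of_nat_dvd_iff)
    then show ?thesis by auto
  qed
  also have "(\<Sum>e | e dvd g \<and> int e dvd x. totient e) =
      (\<Sum>e | e dvd g. if int e dvd x then totient e else 0)"
    using assms by (intro sum.mono_neutral_cong_left) auto
  finally show ?thesis .
qed

lemma sum_gcd_arith_progression:
  fixes g c :: nat and n :: int
  assumes "g > 0"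
  shows "(\<Sum>l = 1..g. gcd (int g) (n + int (l * c))) =
    int (\<Sum>e | e dvd g. totient e * (if int (gcd e c) dvd n then g div e * gcd e c else 0))"
proof -
  have "(\<Sum>l = 1..g. gcd (int g) (n + int (l * c))) =
      int (\<Sum>l = 1..g. \<Sum>e | e dvd g. if int e dvd n + int (l * c) then totient e else 0)"
    by (simp only: sum_totient_common_divisors[OF assms] of_nat_sum)
  also have "(\<Sum>l = 1..g. \<Sum>e | e dvd g. if int e dvd n + int (l * c) then totient e else 0) =
      (\<Sum>e | e dvd g. \<Sum>l = 1..g. if int e dvd n + int (l * c) then totient e else 0)"
    by (rule sum.swap)
  also have "\<dots> = (\<Sum>e | e dvd g. totient e * card {l \<in> {1..g}. int e dvd n + int (l * c)})"
    by (intro sum.cong refl) (simp add: sum.If_cases Int_def)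
  also have "\<dots> = (\<Sum>e | e dvd g. totient e *
      (if int (gcd e c) dvd n then g div e * gcd e c else 0))"
    by (intro sum.cong refl) (simp only: mem_Collect_eq card_linear_cong_solutions[OF assms])
  finally show ?thesis .
qed

text \<open>Double counting of the \<open>a\<close> in \<open>{1..v * h}\<close> coprime to
  \<open>h\<close>. Periodicity gives the right-hand side. Sorting by
  \<open>t = gcd a (v * h)\<close>, which is coprime to \<open>h\<close> and hence divides
  \<open>v\<close>, gives classes of size \<open>totient (v * h div t)\<close>; then
  \<open>e = v div t\<close>.\<close>

lemma sum_totient_coprime_cofactor:
  fixes v h :: nat
  assumes "v > 0" and "h > 0"
  shows "(\<Sum>e | e dvd v \<and> coprime h (v div e). totient (h * e)) = v * totient h"
proof -
  let ?U = "{a \<in> {1..v * h}. coprime a h}"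
  let ?T = "{t. t dvd v \<and> coprime h t}"
  let ?A = "\<lambda>t. {a \<in> {0<..v * h}. gcd a (v * h) = t}"
  have fin: "finite ?T" using assms by simp
  have "v * totient h = v * card {a \<in> {1..h}. coprime a h}"
    by (simp add: totient_def totatives_def greaterThanAtMost_def atLeastAtMost_def Suc_le_eq
        greaterThan_def atLeast_def)
  also have "\<dots> = card ?U"
    using card_periodic[of "\<lambda>a. coprime a h" h v] by (simp add: coprime_iff_gcd_eq_1)
  also have "?U = (\<Union>t \<in> ?T. ?A t)"
  proof (intro equalityI subsetI)
    fix a assume a: "a \<in> ?U"
    then have "coprime h (gcd a (v * h))"
      by (metis (no_types, lifting) coprime_commute coprime_divisors dvd_refl gcd_dvd1 mem_Collect_eq)
    moreover from this have "gcd a (v * h) dvd v"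
      by (metis coprime_commute coprime_dvd_mult_left_iff gcd_dvd2)
    ultimately show "a \<in> (\<Union>t \<in> ?T. ?A t)" using a by auto
  next
    fix a assume "a \<in> (\<Union>t \<in> ?T. ?A t)"
    then have a: "a \<in> {1..v * h}" "coprime h (gcd a (v * h))" by auto
    have "gcd a h dvd gcd a (v * h)" by (simp add: dvd_mult)
    with a(2) have "coprime a h" by (metis coprime_common_divisor gcd_dvd2 is_unit_gcd)
    with a(1) show "a \<in> ?U" by simp
  qed
  also have "card \<dots> = (\<Sum>t \<in> ?T. card (?A t))"
    using fin by (intro card_UN_disjoint) auto
  also have "\<dots> = (\<Sum>t \<in> ?T. totient (h * (v div t)))"
  proof (intro sum.cong refl)
    fix t assume t: "t \<in> ?T"
    then have "card (?A t) = totient (v * h div t)"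
      using assms by (intro card_gcd_eq_totient) auto
    with t show "card (?A t) = totient (h * (v div t))"
      by (metis (no_types, lifting) div_mult_swap mem_Collect_eq mult.commute)
  qed
  also have "\<dots> = (\<Sum>e | e dvd v \<and> coprime h (v div e). totient (h * e))"
    using assms by (intro sum.reindex_bij_witness[of _ "(div) v" "(div) v"]) (auto elim!: dvdE)
  finally show ?thesis ..
qed

section \<open>Rearranging sums over divisors\<close>

text \<open>Writing \<open>d = g * c\<close> with \<open>g = gcd d m\<close>, the condition \<open>d dvd m * M\<close> becomes \<open>c dvd M\<close>,
  because \<open>c\<close> is coprime to \<open>m div g\<close>.\<close>

lemma sum_divisors_mult:
  fixes m M :: nat and F :: "nat \<Rightarrow> nat \<Rightarrow> 'a::comm_monoid_add"
  assumes "m > 0" and "M > 0"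
  shows "(\<Sum>d | d dvd m * M. F (gcd d m) (d div gcd d m)) =
    (\<Sum>c | c dvd M. \<Sum>t | t dvd m \<and> coprime c t. F (m div t) c)"
proof -
  have "(\<Sum>c | c dvd M. \<Sum>t | t dvd m \<and> coprime c t. F (m div t) c) =
      (\<Sum>(c, t) \<in> (SIGMA c : {c. c dvd M}. {t. t dvd m \<and> coprime c t}). F (m div t) c)"
    using assms by (intro sum.Sigma) auto
  also have "\<dots> = (\<Sum>d | d dvd m * M. F (gcd d m) (d div gcd d m))"
  \<comment> \<open>Here \<open>t\<close> is \<open>m div g\<close>, so
    \<open>d = (m div t) * c\<close>; coprimality of \<open>c\<close> and \<open>t\<close> ensures
    that \<open>m div t\<close> is \<open>gcd d m\<close>.\<close>
  proof (rule sum.reindex_bij_witness[of _ "\<lambda>d. (d div gcd d m, m div gcd d m)"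
        "\<lambda>(c, t). m div t * c"], goal_cases)
    case (1 x)
    then obtain c t where x: "x = (c, t)" "c dvd M" "t dvd m" "coprime c t" by auto
    then obtain g where m: "m = t * g" by auto
    have "gcd (g * c) (t * g) = g"
      using x by (metis gcd_mult_distrib_nat mult.commute coprime_iff_gcd_eq_1 mult.right_neutral)
    with assms m x show ?case by auto
  next
    case (2 x)
    then obtain c t where x: "x = (c, t)" "c dvd M" "t dvd m" "coprime c t" by auto
    then obtain g where m: "m = t * g" by auto
    with assms x show ?case by (auto intro: mult_dvd_mono)
  next
    case (3 d)
    obtain t where t: "m = gcd d m * t" using gcd_dvd2 by blast
    with assms have "gcd d m > 0" "t > 0" by (auto intro!: Nat.gr0I)
    then have "m div (m div gcd d m) = gcd d m"
      by (metis t nonzero_mult_div_cancel_left nonzero_mult_div_cancel_right neq0_conv)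
    then show ?case by simp
  next
    case (4 d)
    then have d: "d > 0" "d dvd m * M" using assms by (auto intro!: Nat.gr0I)
    have cop: "coprime (d div gcd d m) (m div gcd d m)"
      using d by (intro div_gcd_coprime) auto
    have "d div gcd d m dvd m * M div gcd d m" using d(2) by (simp add: div_dvd_div)
    then have "d div gcd d m dvd m div gcd d m * M" by (simp add: dvd_div_mult)
    with cop have "d div gcd d m dvd M" by (simp add: coprime_dvd_mult_right_iff)
    moreover have "m div gcd d m dvd m" by (metis dvd_mult_div_cancel dvd_triv_right gcd_dvd2)
    ultimately show ?case using cop by auto
  next
    case (5 x)
    then obtain c t where x: "x = (c, t)" "c dvd M" "t dvd m" "coprime c t" by auto
    then obtain g where m: "m = t * g" by auto
    have "gcd (g * c) (t * g) = g"
      using x by (metis gcd_mult_distrib_nat mult.commute coprime_iff_gcd_eq_1 mult.right_neutral)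
    with assms m x show ?case by auto
  qed
  finally show ?thesis ..
qed

text \<open>The pairs with \<open>e * t\<close> dividing \<open>n\<close> are grouped by the product
  \<open>v = e * t\<close>.\<close>

lemma sum_divisors_quotient:
  fixes n :: nat and F :: "nat \<Rightarrow> nat \<Rightarrow> 'a::comm_monoid_add"
  assumes "n > 0"
  shows "(\<Sum>e | e dvd n. \<Sum>t | t dvd n div e. F e t) = (\<Sum>v | v dvd n. \<Sum>e | e dvd v. F e (v div e))"
proof -
  have pos: "n div e > 0" "e > 0" if "e dvd n" for e
    using that assms by (auto elim!: dvdE)
  have "(\<Sum>e | e dvd n. \<Sum>t | t dvd n div e. F e t) =
      (\<Sum>(e, t) \<in> (SIGMA e : {e. e dvd n}. {t. t dvd n div e}). F e t)"
    using assms pos by (intro sum.Sigma) auto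
  also have "\<dots> = (\<Sum>(v, e) \<in> (SIGMA v : {v. v dvd n}. {e. e dvd v}). F e (v div e))"
    using pos by (intro sum.reindex_bij_witness[of _ "\<lambda>(v, e). (e, v div e)" "\<lambda>(e, t). (e * t, e)"])
      (auto simp: dvd_div_iff_mult mult.commute dest: dvd_trans intro: div_dvd_div)
  also have "\<dots> = (\<Sum>v | v dvd n. \<Sum>e | e dvd v. F e (v div e))"
    using assms pos by (intro sum.Sigma[symmetric]) auto
  finally show ?thesis .
qed

text \<open>Each pair is \<open>h\<close> times a unique coprime pair, with
  \<open>h = gcd c e\<close>; on the right, \<open>e\<close> denotes the cofactor.\<close>

lemma sum_divisor_pairs_by_gcd:
  fixes m M :: nat and F :: "nat \<Rightarrow> nat \<Rightarrow> 'a::comm_monoid_add"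
  assumes "m > 0" and "M > 0"
  shows "(\<Sum>c | c dvd M. \<Sum>e | e dvd m. F c e) =
    (\<Sum>h | h dvd gcd m M. \<Sum>k | k dvd M div h. \<Sum>e | e dvd m div h \<and> coprime k e. F (h * k) (h * e))"
proof -
  have pos: "m div h > 0" "M div h > 0" "h > 0" if "h dvd m" "h dvd M" for h
    using that assms by (auto elim!: dvdE)
  let ?K = "\<lambda>h. SIGMA k : {k. k dvd M div h}. {e. e dvd m div h \<and> coprime k e}"
  have "(\<Sum>c | c dvd M. \<Sum>e | e dvd m. F c e) =
      (\<Sum>(c, e) \<in> {c. c dvd M} \<times> {e. e dvd m}. F c e)"
    by (rule sum.cartesian_product)
  also have "\<dots> = (\<Sum>(h, k, e) \<in> (SIGMA h : {h. h dvd gcd m M}. ?K h). F (h * k) (h * e))"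
  proof (rule sum.reindex_bij_witness[of _ "\<lambda>(h, k, e). (h * k, h * e)"
        "\<lambda>(c, e). (gcd c e, c div gcd c e, e div gcd c e)"], goal_cases)
    case (2 x)
    then obtain c e where x: "x = (c, e)" "c dvd M" "e dvd m" by auto
    with assms have "c > 0" by (auto intro!: Nat.gr0I)
    then show ?case using x by (auto intro: dvd_trans div_gcd_coprime div_dvd_div)
  next
    case (3 x)
    then obtain h k e where x: "x = (h, k, e)" "h dvd m" "h dvd M" "k dvd M div h"
      "e dvd m div h" "coprime k e" by auto
    then have "h > 0" "gcd (h * k) (h * e) = h"
      using pos by (auto simp flip: gcd_mult_distrib_nat)
    with x show ?case by auto
  next
    case (4 x)
    then obtain h k e where x: "x = (h, k, e)" "h dvd m" "h dvd M" "k dvd M div h" "e dvd m div h"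
      by auto
    then have "k * h dvd M" "e * h dvd m"
      using pos(3) by (simp_all add: dvd_div_iff_mult)
    with x show ?case by (simp add: mult.commute)
  qed auto
  also have "\<dots> = (\<Sum>h | h dvd gcd m M. \<Sum>(k, e) \<in> ?K h. F (h * k) (h * e))"
    using assms pos by (intro sum.Sigma[symmetric]) auto
  also have "\<dots> = (\<Sum>h | h dvd gcd m M. \<Sum>k | k dvd M div h.
      \<Sum>e | e dvd m div h \<and> coprime k e. F (h * k) (h * e))"
    using assms pos by (intro sum.cong refl sum.Sigma[symmetric]) auto
  finally show ?thesis .
qed


lemma sum_divisors_quotient_swap:
  fixes n :: nat and F :: "nat \<Rightarrow> nat \<Rightarrow> 'a::comm_monoid_add"
  assumes "n > 0"
  shows "(\<Sum>t | t dvd n. \<Sum>e | e dvd n div t. F t e) = (\<Sum>e | e dvd n. \<Sum>t | t dvd n div e. F t e)"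
proof -
  have "(\<Sum>t | t dvd v. F t (v div t)) = (\<Sum>e | e dvd v. F (v div e) e)" if "v dvd n" for v
  proof -
    have "v > 0" using that assms by (auto intro!: Nat.gr0I)
    then show ?thesis
      by (intro sum.reindex_bij_witness[of _ "(div) v" "(div) v"]) (auto elim!: dvdE)
  qed
  then show ?thesis
    using assms by (simp add: sum_divisors_quotient)
qed

section \<open>The left-hand side as a sum over \<open>h\<close>\<close>

text \<open>For \<open>v = e * t\<close> the conditions say that \<open>k\<close> is coprime to
  \<open>v\<close> and \<open>h\<close> to \<open>t = v div e\<close>. Summing over \<open>e\<close>
  for fixed \<open>v\<close> gives \<open>v * totient h\<close>, and the weight
  \<open>n div v\<close> makes the result independent of \<open>v\<close>.\<close>

lemma sum_totient_coprime_divisor_pairs: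
  fixes n h k :: nat
  assumes "n > 0" and "h > 0"
  shows "(\<Sum>e | e dvd n \<and> coprime k e. \<Sum>t | t dvd n div e \<and> coprime (h * k) t.
      totient (h * e) * (n div e div t)) = n * totient h * card {v. v dvd n \<and> coprime k v}"
proof -
  have pos: "n div e > 0" "e > 0" if "e dvd n" for e
    using that assms by (auto elim!: dvdE)
  \<comment> \<open>Extension by zero frees the ranges of \<open>e\<close> and \<open>t\<close> from
    coprimality, so that the pairs can be regrouped by product.\<close>
  define f where "f e t = (if coprime k (e * t) \<and> coprime h t
    then totient (h * e) * (n div (e * t)) else 0)" for e t
  have "(\<Sum>e | e dvd n \<and> coprime k e. \<Sum>t | t dvd n div e \<and> coprime (h * k) t.
      totient (h * e) * (n div e div t)) = (\<Sum>e | e dvd n \<and> coprime k e. \<Sum>t | t dvd n div e. f e t)"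
    using pos by (intro sum.cong refl sum.mono_neutral_cong_left) (auto simp: f_def div_mult2_eq)
  also have "\<dots> = (\<Sum>e | e dvd n. \<Sum>t | t dvd n div e. f e t)"
    using assms by (intro sum.mono_neutral_left) (auto simp: f_def)
  also have "\<dots> = (\<Sum>v | v dvd n. \<Sum>e | e dvd v. f e (v div e))"
    using assms(1) by (rule sum_divisors_quotient)
  also have "\<dots> = (\<Sum>v | v dvd n \<and> coprime k v. \<Sum>e | e dvd v. f e (v div e))"
    using assms by (intro sum.mono_neutral_right) (auto simp: f_def)
  also have "\<dots> = (\<Sum>v | v dvd n \<and> coprime k v. n * totient h)"
  proof (intro sum.cong refl)
    fix v assume "v \<in> {v. v dvd n \<and> coprime k v}"
    then have v: "v dvd n" "coprime k v" "v > 0" using pos by auto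
    then have "(\<Sum>e | e dvd v. f e (v div e)) =
        (\<Sum>e | e dvd v \<and> coprime h (v div e). totient (h * e) * (n div v))"
      by (intro sum.mono_neutral_cong_right) (auto simp: f_def)
    also have "\<dots> = v * totient h * (n div v)"
      using assms v by (simp add: sum_totient_coprime_cofactor flip: sum_distrib_right)
    finally show "(\<Sum>e | e dvd v. f e (v div e)) = n * totient h"
      using v by (auto elim!: dvdE)
  qed
  finally show ?thesis by simp
qed

lemma sum_divisors_totient_gcd:
  fixes m M :: nat and P :: "nat \<Rightarrow> bool"
  assumes "m > 0" and "M > 0"
  shows "(\<Sum>d | d dvd m * M. \<Sum>e | e dvd gcd d m. totient e *
      (if P (gcd e (d div gcd d m)) then gcd d m div e * gcd e (d div gcd d m) else 0)) =
    m * (\<Sum>h | h dvd gcd m M \<and> P h. totient h * card {d. d dvd (m div h) * (M div h)})"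
proof -
  have pos: "m div h > 0" "M div h > 0" "h > 0" if "h dvd m" "h dvd M" for h
    using that assms by (auto elim!: dvdE)
  \<comment> \<open>The argument \<open>q\<close> stands for \<open>g div e\<close>, which is
    \<open>m div t div e\<close> when \<open>g = m div t\<close>.\<close>
  define w where "w c e q = totient e * (if P (gcd e c) then q * gcd e c else 0)" for c e q
  have "(\<Sum>d | d dvd m * M. \<Sum>e | e dvd gcd d m. totient e *
      (if P (gcd e (d div gcd d m)) then gcd d m div e * gcd e (d div gcd d m) else 0)) =
      (\<Sum>c | c dvd M. \<Sum>t | t dvd m \<and> coprime c t. \<Sum>e | e dvd m div t. w c e (m div t div e))"
    unfolding w_def
    using sum_divisors_mult[OF assms, of "\<lambda>g c. \<Sum>e | e dvd g. totient e *
        (if P (gcd e c) then g div e * gcd e c else 0)"] by simp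
  \<comment> \<open>Exchanging \<open>t\<close> and \<open>e\<close> lets \<open>e\<close> range
    over all divisors of \<open>m\<close>, independently of \<open>c\<close>, so that the pairs
    \<open>(c, e)\<close> can be sorted by gcd.\<close>
  also have "\<dots> = (\<Sum>c | c dvd M. \<Sum>e | e dvd m. \<Sum>t | t dvd m div e \<and> coprime c t. w c e (m div e div t))"
  proof (rule sum.cong[OF refl])
    fix c
    have div_commute: "m div t div e = m div e div t" for t e
      by (metis div_mult2_eq mult.commute)
    have "(\<Sum>t | t dvd m \<and> coprime c t. \<Sum>e | e dvd m div t. w c e (m div t div e)) =
        (\<Sum>t | t dvd m. \<Sum>e | e dvd m div t. if coprime c t then w c e (m div t div e) else 0)"
      using assms by (intro sum.mono_neutral_cong_left) auto
    also have "\<dots> = (\<Sum>e | e dvd m. \<Sum>t | t dvd m div e. if coprime c t then w c e (m div t div e) else 0)"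
      using assms(1) by (rule sum_divisors_quotient_swap)
    also have "\<dots> = (\<Sum>e | e dvd m. \<Sum>t | t dvd m div e \<and> coprime c t. w c e (m div e div t))"
      using assms by (intro sum.cong refl sum.mono_neutral_cong_right)
        (auto simp: div_commute intro!: finite_divisors_nat Nat.gr0I)
    finally show "(\<Sum>t | t dvd m \<and> coprime c t. \<Sum>e | e dvd m div t. w c e (m div t div e)) = \<dots>" .
  qed
  also have "\<dots> = (\<Sum>h | h dvd gcd m M. \<Sum>k | k dvd M div h. \<Sum>e | e dvd m div h \<and> coprime k e.
      \<Sum>t | t dvd m div (h * e) \<and> coprime (h * k) t. w (h * k) (h * e) (m div (h * e) div t))"
    by (rule sum_divisor_pairs_by_gcd[OF assms, of "\<lambda>c e. \<Sum>t | t dvd m div e \<and> coprime c t. w c e (m div e div t)"])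
  also have "\<dots> = (\<Sum>h | h dvd gcd m M. if P h then m * (totient h * card {d. d dvd (m div h) * (M div h)}) else 0)"
  proof (intro sum.cong refl)
    fix h assume "h \<in> {h. h dvd gcd m M}"
    then have h: "h dvd m" "h dvd M" by auto
    have "(\<Sum>k | k dvd M div h. \<Sum>e | e dvd m div h \<and> coprime k e.
        \<Sum>t | t dvd m div (h * e) \<and> coprime (h * k) t. w (h * k) (h * e) (m div (h * e) div t)) =
      (\<Sum>k | k dvd M div h. \<Sum>e | e dvd m div h \<and> coprime k e.
        \<Sum>t | t dvd m div h div e \<and> coprime (h * k) t.
          (if P h then h else 0) * (totient (h * e) * (m div h div e div t)))"
    proof (intro sum.cong)
      fix k e t assume "e \<in> {e. e dvd m div h \<and> coprime k e}"
      then have "gcd (h * e) (h * k) = h"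
        by (simp add: coprime_commute flip: gcd_mult_distrib_nat)
      then show "w (h * k) (h * e) (m div (h * e) div t) =
          (if P h then h else 0) * (totient (h * e) * (m div h div e div t))"
        by (simp add: w_def div_mult2_eq)
    qed (simp_all add: div_mult2_eq)
    also have "\<dots> = (if P h then h else 0) * (\<Sum>k | k dvd M div h.
        m div h * totient h * card {v. v dvd m div h \<and> coprime k v})"
      using pos[OF h] sum_totient_coprime_divisor_pairs[of "m div h" h]
      by (simp only: flip: sum_distrib_left)
    also have "\<dots> = (if P h then h else 0) * (m div h * totient h * card {d. d dvd (m div h) * (M div h)})"
    proof -
      \<comment> \<open>Coprime pairs of divisors are counted by the divisors of the product: the
        reindexing lemma for the constant 1.\<close>
      have "(\<Sum>k | k dvd M div h. card {v. v dvd m div h \<and> coprime k v}) =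
          card {d. d dvd (m div h) * (M div h)}"
        using sum_divisors_mult[OF pos(1,2)[OF h], of "\<lambda>_ _. 1 :: nat"] by simp
      then show ?thesis by (simp flip: sum_distrib_left)
    qed
    \<comment> \<open>The factor \<open>h\<close>, coming from the gcd in \<open>w\<close>,
      completes \<open>m div h\<close> to \<open>m\<close>.\<close>
    also have "\<dots> = (if P h then m * (totient h * card {d. d dvd (m div h) * (M div h)}) else 0)"
      using h by (auto simp flip: mult.assoc)
    finally show "(\<Sum>k | k dvd M div h. \<Sum>e | e dvd m div h \<and> coprime k e.
        \<Sum>t | t dvd m div (h * e) \<and> coprime (h * k) t. w (h * k) (h * e) (m div (h * e) div t)) = \<dots>" .
  qed
  also have "\<dots> = (\<Sum>h | h dvd gcd m M \<and> P h. m * (totient h * card {d. d dvd (m div h) * (M div h)}))"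
    using assms by (intro sum.mono_neutral_cong_right) auto
  finally show ?thesis by (simp add: sum_distrib_left)
qed

section \<open>The right-hand side as a sum over \<open>h\<close>\<close>

text \<open>In the totient expansion of the gcd, divisibility of \<open>m\<close>, \<open>M\<close>
  and \<open>n\<close> by \<open>h\<close> does not involve \<open>d\<close>, so the sums can be
  exchanged; it remains to count the \<open>d\<close> with \<open>h\<close> dividing
  \<open>d\<close> and its complementary divisor.\<close>

lemma sum_divisors_Gcd:
  fixes m M :: nat and n :: int
  assumes "m > 0" and "M > 0"
  shows "(\<Sum>d | d dvd m * M. Gcd {int d, int m, int (m * M div d), int M, n}) =
    int (\<Sum>h | h dvd gcd m M \<and> int h dvd n. totient h * card {d. d dvd (m div h) * (M div h)})"
proof -
  let ?N = "m * M" and ?H = "{h. h dvd gcd m M \<and> int h dvd n}"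
  have finH: "finite ?H" using assms by simp
  have "Gcd {int d, int m, int (?N div d), int M, n} =
      int (\<Sum>h \<in> ?H. if h dvd d \<and> h dvd ?N div d then totient h else 0)" for d
  proof -
    define G where "G = Gcd {int d, int m, int (?N div d), int M, n}"
    have "G \<ge> 0" by (simp add: G_def)
    then have dvd: "h dvd nat G \<longleftrightarrow> int h dvd G" for h
      by (metis int_nat_eq of_nat_dvd_iff)
    have "nat G = (\<Sum>h | h dvd nat G. totient h)" by (simp add: totient_divisor_sum)
    also have "{h. h dvd nat G} = {h \<in> ?H. h dvd d \<and> h dvd ?N div d}"
      unfolding dvd by (auto simp: G_def)
    also have "(\<Sum>h | h \<in> ?H \<and> h dvd d \<and> h dvd ?N div d. totient h) =
        (\<Sum>h \<in> ?H. if h dvd d \<and> h dvd ?N div d then totient h else 0)"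
      using finH by (rule sum.inter_filter)
    finally show ?thesis using \<open>G \<ge> 0\<close> unfolding G_def by linarith
  qed
  then have "(\<Sum>d | d dvd ?N. Gcd {int d, int m, int (?N div d), int M, n}) =
      int (\<Sum>d | d dvd ?N. \<Sum>h \<in> ?H. if h dvd d \<and> h dvd ?N div d then totient h else 0)"
    by simp
  also have "(\<Sum>d | d dvd ?N. \<Sum>h \<in> ?H. if h dvd d \<and> h dvd ?N div d then totient h else 0) =
      (\<Sum>h \<in> ?H. \<Sum>d | d dvd ?N. if h dvd d \<and> h dvd ?N div d then totient h else 0)"
    by (rule sum.swap)
  also have "\<dots> = (\<Sum>h \<in> ?H. totient h * card {d. d dvd (m div h) * (M div h)})"
  proof (intro sum.cong refl)
    fix h assume "h \<in> ?H"
    then obtain a b where ab: "m = h * a" "M = h * b" by (auto elim!: dvdE)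
    with assms have pos: "h > 0" "a > 0" "b > 0" by auto
    \<comment> \<open>If \<open>d * r = a * b\<close>, then \<open>h * d\<close> and
      \<open>h * r\<close> are complementary divisors of \<open>m * M = h * h * (a * b)\<close>, and
      conversely.\<close>
    have "bij_betw ((*) h) {d. d dvd a * b} {d. d dvd ?N \<and> h dvd d \<and> h dvd ?N div d}"
    proof (rule bij_betw_byWitness[where f' = "\<lambda>d. d div h"], goal_cases)
      case 3
      have "h * d dvd ?N \<and> h dvd ?N div (h * d)" if d: "d dvd a * b" for d
      proof -
        obtain r where "a * b = d * r" using d by auto
        then have N: "?N = h * d * (h * r)" by (simp add: ab mult_ac)
        moreover from this have "h * d > 0" using assms by (auto intro!: Nat.gr0I)
        ultimately show ?thesis by simp
      qed
      then show ?case by auto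
    next
      case 4
      have "d div h dvd a * b" if d: "d dvd ?N" "h dvd d" "h dvd ?N div d" for d
      proof -
        obtain r s where rs: "d = h * r" "?N div d = h * s" using d by (auto elim!: dvdE)
        then have "?N = h * r * (h * s)" using d by (metis dvd_mult_div_cancel)
        then have "a * b = r * s" using pos by (simp add: ab mult_ac)
        then show ?thesis using rs pos by simp
      qed
      then show ?case by auto
    qed (use pos in auto)
    then have "card {d. d dvd a * b} = card {d. d dvd ?N \<and> h dvd d \<and> h dvd ?N div d}"
      by (rule bij_betw_same_card)
    moreover have "(\<Sum>d | d dvd ?N. if h dvd d \<and> h dvd ?N div d then totient h else 0) =
        (\<Sum>d | d dvd ?N \<and> h dvd d \<and> h dvd ?N div d. totient h)"
      using assms by (intro sum.mono_neutral_cong_right) auto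
    ultimately show "(\<Sum>d | d dvd ?N. if h dvd d \<and> h dvd ?N div d then totient h else 0) =
        totient h * card {d. d dvd (m div h) * (M div h)}"
      using pos by (simp add: ab)
  qed
  finally show ?thesis .
qed

theorem mainTheorem1:
  fixes N m :: nat and n :: int
  assumes "N \<ge> 1" and "m \<ge> 1" and "m dvd N"
  shows "int (N div m) * (\<Sum>d | d dvd N. \<Sum>l = 1..gcd d m.
            gcd (int (gcd d m)) (n + int ((l * d) div gcd d m)))
       = int N * (\<Sum>d | d dvd N. 
            Gcd {int d, int m, int (N div d), int (N div m), n})"
proof -
  obtain M where N: "N = m * M" using assms by auto
  with assms have pos: "m > 0" "M > 0" by auto
  have "(\<Sum>l = 1..gcd d m. gcd (int (gcd d m)) (n + int ((l * d) div gcd d m))) =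
      int (\<Sum>e | e dvd gcd d m. totient e * (if int (gcd e (d div gcd d m)) dvd n
        then gcd d m div e * gcd e (d div gcd d m) else 0))" for d
    using sum_gcd_arith_progression[of "gcd d m" n "d div gcd d m"] pos
    by (simp add: div_mult_swap)
  then have "(\<Sum>d | d dvd N. \<Sum>l = 1..gcd d m.
      gcd (int (gcd d m)) (n + int ((l * d) div gcd d m))) =
      int (\<Sum>d | d dvd m * M. \<Sum>e | e dvd gcd d m. totient e *
        (if int (gcd e (d div gcd d m)) dvd n then gcd d m div e * gcd e (d div gcd d m) else 0))"
    by (simp only: N of_nat_sum)
  \<comment> \<open>Both sums equal the same sum over \<open>h\<close>, up to the factor
    \<open>m\<close>; together with \<open>N div m = M\<close> this factor makes up
    \<open>N\<close>.\<close>
  also have "\<dots> = int m * (\<Sum>d | d dvd N. Gcd {int d, int m, int (N div d), int (N div m), n})"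
    using sum_divisors_totient_gcd[OF pos, of "\<lambda>h. int h dvd n"] sum_divisors_Gcd[OF pos, of n] pos
    by (simp add: N)
  finally show ?thesis using pos by (simp add: N)
qed

end
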